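(* Consider the system $x(k+1)=F(x(k))$ and let $b_i\ge 1$ for all $i\in\mathcal{V}$. Suppose that the neighbor graph $\mathbb{G}$ is strongly connected. Then: (1) If $x_i(0)\ge 0.5$ for all $i\in\mathcal{V}$ and there exists at least one $j\in\mathcal{V}$ such that $x_j(0)>0.5$, then $x_i(k)$ converges to $1$ as $k\to\infty$ for all $i\in\mathcal{V}$. (2) If $x_i(0)\le 0.5$ for all $i\in\mathcal{V}$ and there exists at least one $j\in\mathcal{V}$ such that $x_j(0)<0.5$, then $x_i(k)$ converges to $0$ as $k\to\infty$ for all $i\in\mathcal{V}$.
   Context: There are $N\ge 2$ agents, $\mathcal{V}=\{1,\dots,N\}$. $\mathbb{G}=(\mathcal{V},\mathcal{E})$ is a directed graph without self-loops, $\mathcal{N}_i=\{j\in\mathcal{V}:(j,i)\in\mathcal{E}\}$ is the set of neighbors of agent $i$ (so $i\notin\mathcal{N}_i$). The weight matrix $W=(w_{ij})_{N\times N}$ is real with $w_{ii}\ge 0$ for all $i$ and $w_{ij}>0$ whenever $(j,i)\in\mathcal{E}$. $\mathbb{G}$ is strongly connected if there is a directed path from every node to every other node. Each agent $i$ has a real bias parameter $b_i$. Put $d_i=\sum_{j\in\mathcal{N}_i}w_{ij}$ and, for $x=(x_1,\dots,x_N)^\top$, $s_i=\sum_{j\in\mathcal{N}_i}w_{ij}x_j$ and $$f_i(x)=\frac{w_{ii}x_i+x_i^{b_i}s_i}{w_{ii}+x_i^{b_i}s_i+(1-x_i)^{b_i}(d_i-s_i)},\qquad F(x)=[f_1(x),\dots,f_N(x)]^\top.$$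 The opinion dynamics is $x(k+1)=F(x(k))$, $k=0,1,2,\dots$, with $x_i(0)\in[0,1]$ for all $i$. *)

theory Defs
  imports "HOL-Analysis.Analysis"
    "Graph_Theory.Digraph_Component"
    "Graph_Theory.Pair_Digraph"
begin

text \<open>
  Agents are the elements of a finite type, so that opinion profiles live in \<^typ>\<open>real ^ 'n\<close>.
  An arc \<open>(j, i)\<close> means that \<open>i\<close> is influenced by \<open>j\<close>.
\<close>

definition neighbors :: "'n pair_pre_digraph \<Rightarrow> 'n \<Rightarrow> 'n set" where
  "neighbors G i = {j \<in> pverts G. (j, i) \<in> parcs G}"

definition weighted_degree ::
  "('n::finite) pair_pre_digraph \<Rightarrow> real ^ 'n ^ 'n \<Rightarrow> 'n \<Rightarrow> real" where
  "weighted_degree G W i = (\<Sum>j\<in>neighbors G i. W $ i $ j)"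

definition weighted_opinion ::
  "('n::finite) pair_pre_digraph \<Rightarrow> real ^ 'n ^ 'n \<Rightarrow> real ^ 'n \<Rightarrow> 'n \<Rightarrow> real" where
  "weighted_opinion G W x i = (\<Sum>j\<in>neighbors G i. W $ i $ j * x $ j)"

text \<open>
  The biased assimilation map. For a bias \<open>\<ge> 1\<close> and a base in \<open>[0, 1]\<close>,
  \<^const>\<open>powr\<close> is the usual power, including the value \<open>0\<close> at base \<open>0\<close>.
\<close>

definition opinion_map ::
  "('n::finite) pair_pre_digraph \<Rightarrow> real ^ 'n ^ 'n \<Rightarrow> real ^ 'n \<Rightarrow> real ^ 'n \<Rightarrow> real ^ 'n" where
  "opinion_map G W b x = (\<chi> i.
     let d = weighted_degree G W i; s = weighted_opinion G W x i in
     (W $ i $ i * x $ i + (x $ i) powr (b $ i) * s) /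
     (W $ i $ i + (x $ i) powr (b $ i) * s + (1 - x $ i) powr (b $ i) * (d - s)))"

end

theory Submission
  imports Defs
begin

text \<open>
  Write \<open>p = x\<^sub>i powr (b\<^sub>i - 1)\<close> and \<open>q = (1 - x\<^sub>i) powr (b\<^sub>i - 1)\<close>. One step moves agent \<open>i\<close> by a
  positive multiple of \<open>x\<^sub>i (1 - x\<^sub>i) (p s\<^sub>i - q (d\<^sub>i - s\<^sub>i))\<close>. If all opinions lie in \<open>[1/2, 1]\<close>,
  then \<open>p \<ge> q\<close> and \<open>s\<^sub>i \<ge> d\<^sub>i - s\<^sub>i\<close>, so no opinion ever decreases (lemma \<open>update_ge\<close>), while
  none exceeds \<open>1\<close>. Each opinion therefore converges, and by continuity the limit profile is a
  fixed point of the map.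

  A fixed point in \<open>[1/2, 1]\<close> is rigid: an agent with a neighbour strictly above \<open>1/2\<close> has
  \<open>s\<^sub>i > d\<^sub>i - s\<^sub>i\<close>, so its displacement can vanish only at \<open>x\<^sub>i = 1\<close>. The agent that
  starts above \<open>1/2\<close> stays above it in the limit, and the property spreads along the arcs to
  all agents because the graph is strongly connected. Since every agent has some
  neighbour, every limit is \<open>1\<close> (lemma \<open>fixed_point_eq_1\<close>).

  The second claim is the first one seen through the reflection \<open>x \<mapsto> 1 - x\<close>, which exchanges \<open>s\<close>
  with \<open>d - s\<close> and commutes with the map wherever the denominators are nonzero, in particular on
  profiles in \<open>[1/2, 1]\<close> (lemma \<open>opinion_map_reflect\<close>).
\<close>

section \<open>The update of a single agent\<close>

definition denominator :: "real \<Rightarrow> real \<Rightarrow> real \<Rightarrow> real \<Rightarrow> real \<Rightarrow> real" where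
  "denominator w b d s x = w + x powr b * s + (1 - x) powr b * (d - s)"

definition update :: "real \<Rightarrow> real \<Rightarrow> real \<Rightarrow> real \<Rightarrow> real \<Rightarrow> real" where
  "update w b d s x = (w * x + x powr b * s) / denominator w b d s x"

lemma denominator_reflect: "denominator w b d (d - s) (1 - x) = denominator w b d s x"
  by (simp add: denominator_def)

lemma update_reflect:
  assumes "denominator w b d s x \<noteq> 0"
  shows "update w b d (d - s) (1 - x) = 1 - update w b d s x"
proof -
  have "1 - update w b d s x = (w * (1 - x) + (1 - x) powr b * (d - s)) / denominator w b d s x"
    using assms by (simp add: update_def field_simps) (simp add: denominator_def algebra_simps)
  then show ?thesis
    by (simp add: update_def denominator_reflect)
qed

lemma denominator_pos:
  assumes "0 \<le> w" "0 < x" "0 < s" "s \<le> d"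
  shows "0 < denominator w b d s x"
proof -
  have "0 < x powr b * s" "0 \<le> (1 - x) powr b * (d - s)"
    using assms by auto
  then show ?thesis
    unfolding denominator_def using assms by linarith
qed

lemma update_le_1:
  assumes "0 \<le> w" "0 < x" "x \<le> 1" "0 < s" "s \<le> d"
  shows "update w b d s x \<le> 1"
proof -
  have "w * x \<le> w" "0 \<le> (1 - x) powr b * (d - s)"
    using assms by (auto intro: mult_left_le)
  then have "w * x + x powr b * s \<le> denominator w b d s x"
    unfolding denominator_def by linarith
  then show ?thesis
    using denominator_pos[of w x s d b] assms by (simp add: update_def)
qed

text \<open>
  The displacement with the common factor \<open>x * (1 - x)\<close> pulled out of both powers. What remains
  is the imbalance between the pull towards \<open>1\<close> and the pull towards \<open>0\<close>.
\<close>

lemma update_displacement: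
  assumes "0 < x" "x \<le> 1" "denominator w b d s x \<noteq> 0"
  shows "update w b d s x - x =
    x * (1 - x) * (x powr (b - 1) * s - (1 - x) powr (b - 1) * (d - s)) / denominator w b d s x"
proof -
  have X: "x powr b = x * x powr (b - 1)" and Y: "(1 - x) powr b = (1 - x) * (1 - x) powr (b - 1)"
    using assms powr_mult_base[of x "b - 1"] powr_mult_base[of "1 - x" "b - 1"] by auto
  have "update w b d s x - x = ((1 - x) * (x powr b * s) - x * ((1 - x) powr b * (d - s)))
      / denominator w b d s x"
    using assms by (simp add: update_def field_simps) (simp add: denominator_def algebra_simps)
  also have "(1 - x) * (x powr b * s) - x * ((1 - x) powr b * (d - s)) =
      x * (1 - x) * (x powr (b - 1) * s - (1 - x) powr (b - 1) * (d - s))"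
    unfolding X Y by (simp add: algebra_simps)
  finally show ?thesis .
qed

lemma update_ge:
  assumes "0 \<le> w" "1 \<le> b" "1/2 \<le> x" "x \<le> 1" "0 < d" "d/2 \<le> s" "s \<le> d"
  shows "x \<le> update w b d s x"
proof -
  have D: "0 < denominator w b d s x"
    using assms by (intro denominator_pos) auto
  have "(1 - x) powr (b - 1) * (d - s) \<le> x powr (b - 1) * s"
    using assms by (intro mult_mono powr_mono2) auto
  then have "0 \<le> update w b d s x - x"
    using assms D by (subst update_displacement) auto
  then show ?thesis by simp
qed

lemma update_fixed_eq_1:
  assumes "0 \<le> w" "1 \<le> b" "1/2 \<le> x" "x \<le> 1" "0 < d" "d/2 < s" "s \<le> d"
    and fixed: "update w b d s x = x"
  shows "x = 1"
proof -
  have D: "0 < denominator w b d s x"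
    using assms by (intro denominator_pos) auto
  have "(1 - x) powr (b - 1) * (d - s) \<le> x powr (b - 1) * (d - s)"
    using assms by (intro mult_right_mono powr_mono2) auto
  also have "\<dots> < x powr (b - 1) * s"
    using assms by (intro mult_strict_left_mono) auto
  finally have "x powr (b - 1) * s - (1 - x) powr (b - 1) * (d - s) > 0"
    by simp
  moreover have "x * (1 - x) * (x powr (b - 1) * s - (1 - x) powr (b - 1) * (d - s)) = 0"
    using update_displacement[of x w b d s] fixed D assms by auto
  ultimately show ?thesis
    using assms by auto
qed

text \<open>
  The power \<open>(1 - x) powr b\<close> is continuous in \<open>x\<close> up to the boundary value \<open>x = 1\<close> because
  \<open>b\<close> is positive; for \<open>b = 0\<close> it would jump there.
\<close>

lemma tendsto_update:
  assumes s: "s' \<longlonglongrightarrow> s" and x: "x' \<longlonglongrightarrow> x"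
    and "0 < b" "0 < x" "\<And>k. x' k \<le> 1" "denominator w b d s x \<noteq> 0"
  shows "(\<lambda>k. update w b d (s' k) (x' k)) \<longlonglongrightarrow> update w b d s x"
proof -
  have X: "(\<lambda>k. x' k powr b) \<longlonglongrightarrow> x powr b"
    using assms by (intro tendsto_powr x tendsto_const) auto
  have Y: "(\<lambda>k. (1 - x' k) powr b) \<longlonglongrightarrow> (1 - x) powr b"
    using assms by (intro tendsto_powr' tendsto_diff x tendsto_const) auto
  show ?thesis
    using assms(6) unfolding update_def denominator_def
    by (intro tendsto_intros X Y s x)
qed

section \<open>Opinion dynamics on a strongly connected graph\<close>

locale biased_network =
  fixes G :: "('n::finite) pair_pre_digraph"
    and W :: "real ^ 'n ^ 'n"
    and b :: "real ^ 'n"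
  assumes two_agents: "CARD('n) \<ge> 2"
    and verts: "pverts G = UNIV"
    and connected: "strongly_connected (with_proj G)"
    and self_weight: "\<And>i. W $ i $ i \<ge> 0"
    and arc_weight: "\<And>i j. (j, i) \<in> parcs G \<Longrightarrow> W $ i $ j > 0"
    and bias: "\<And>i. b $ i \<ge> 1"
begin

abbreviation "deg \<equiv> weighted_degree G W"
abbreviation "opn \<equiv> weighted_opinion G W"

definition upper :: "(real ^ 'n) set" where
  "upper = {x. \<forall>i. 1/2 \<le> x $ i \<and> x $ i \<le> 1}"

lemma in_neighbors: "j \<in> neighbors G i \<longleftrightarrow> (j, i) \<in> parcs G"
  by (simp add: neighbors_def verts)

lemma reachable: "(u, v) \<in> (parcs G)\<^sup>*"
proof -
  have "u \<rightarrow>\<^sup>*\<^bsub>with_proj G\<^esub> v"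
    using connected by (auto simp: strongly_connected_def verts)
  then show ?thesis
    by (auto dest: reachable_rtranclI)
qed

lemma ex_neighbor: "\<exists>j. (j, i) \<in> parcs G"
proof -
  have "UNIV \<noteq> {i}"
  proof
    assume "UNIV = {i}"
    then have "CARD('n) = card {i}" by (rule arg_cong)
    then show False using two_agents by simp
  qed
  then obtain v where "v \<noteq> i" by auto
  with reachable[of v i] show ?thesis
    by (auto elim: rtranclE)
qed

lemma degree_pos: "0 < deg i"
  unfolding weighted_degree_def
  using ex_neighbor[of i] arc_weight by (intro sum_pos) (auto simp: in_neighbors)

lemma opinion_map_nth:
  "opinion_map G W b x $ i = update (W $ i $ i) (b $ i) (deg i) (opn x i) (x $ i)"
  by (simp add: opinion_map_def update_def denominator_def Let_def)

lemma weighted_opinion_reflect: "opn (1 - x) i = deg i - opn x i"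
  by (simp add: weighted_opinion_def weighted_degree_def algebra_simps sum_subtractf)

lemma weighted_opinion_bounds:
  assumes "x \<in> upper"
  shows "deg i / 2 \<le> opn x i" "opn x i \<le> deg i"
proof -
  have "W $ i $ j / 2 \<le> W $ i $ j * x $ j \<and> W $ i $ j * x $ j \<le> W $ i $ j"
    if "j \<in> neighbors G i" for j
    using arc_weight[of j i] assms that
    by (auto simp: in_neighbors upper_def field_simps)
  then show "deg i / 2 \<le> opn x i" "opn x i \<le> deg i"
    unfolding weighted_degree_def weighted_opinion_def sum_divide_distrib
    by (auto intro: sum_mono)
qed

lemma weighted_opinion_gt:
  assumes "x \<in> upper" "(j, i) \<in> parcs G" "1/2 < x $ j"
  shows "deg i / 2 < opn x i"
  unfolding weighted_degree_def weighted_opinion_def sum_divide_distrib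
proof (rule sum_strict_mono_ex1)
  show "\<forall>j\<in>neighbors G i. W $ i $ j / 2 \<le> W $ i $ j * x $ j"
    using arc_weight assms(1) by (fastforce simp: in_neighbors upper_def field_simps)
  show "\<exists>j\<in>neighbors G i. W $ i $ j / 2 < W $ i $ j * x $ j"
    using arc_weight assms by (intro bexI[of _ j]) (auto simp: in_neighbors field_simps)
qed simp

lemma denominator_pos_upper:
  assumes "x \<in> upper"
  shows "0 < denominator (W $ i $ i) (b $ i) (deg i) (opn x i) (x $ i)"
proof (rule denominator_pos)
  show "0 < x $ i"
    using assms by (auto simp: upper_def intro: less_le_trans[of 0 "1/2"])
qed (use weighted_opinion_bounds[OF assms, of i] degree_pos[of i] self_weight in auto)

lemma opinion_map_ge:
  assumes "x \<in> upper"
  shows "x $ i \<le> opinion_map G W b x $ i"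
  unfolding opinion_map_nth
  using assms weighted_opinion_bounds[OF assms, of i] degree_pos[of i] self_weight[of i] bias[of i]
  by (intro update_ge) (auto simp: upper_def)

lemma opinion_map_upper:
  assumes "x \<in> upper"
  shows "opinion_map G W b x \<in> upper"
proof -
  have "1/2 \<le> opinion_map G W b x $ i" for i
    using assms opinion_map_ge[OF assms, of i] by (auto simp: upper_def intro: order_trans)
  moreover have "opinion_map G W b x $ i \<le> 1" for i
  proof -
    have "1/2 \<le> x $ i" "x $ i \<le> 1"
      using assms by (auto simp: upper_def)
    then show ?thesis
      unfolding opinion_map_nth
      using weighted_opinion_bounds[OF assms, of i] degree_pos[of i] self_weight[of i]
      by (intro update_le_1) auto
  qed
  ultimately show ?thesis
    by (simp add: upper_def)
qed

lemma opinion_map_reflect: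
  assumes "x \<in> upper"
  shows "opinion_map G W b (1 - x) = 1 - opinion_map G W b x"
  using denominator_pos_upper[OF assms]
  by (simp add: vec_eq_iff opinion_map_nth weighted_opinion_reflect update_reflect less_imp_neq
      less_imp_neq[symmetric])

lemma tendsto_opinion_map:
  assumes lim: "x' \<longlonglongrightarrow> x" and "\<And>k. x' k \<in> upper" "x \<in> upper"
  shows "(\<lambda>k. opinion_map G W b (x' k)) \<longlonglongrightarrow> opinion_map G W b x"
proof (rule vec_tendstoI)
  fix i
  have x: "(\<lambda>k. x' k $ j) \<longlonglongrightarrow> x $ j" for j
    using lim by (rule tendsto_vec_nth)
  have "1/2 \<le> x $ i" "x' k $ i \<le> 1" for k
    using assms by (auto simp: upper_def)
  moreover have "(\<lambda>k. opn (x' k) i) \<longlonglongrightarrow> opn x i"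
    unfolding weighted_opinion_def by (intro tendsto_intros x)
  ultimately show "(\<lambda>k. opinion_map G W b (x' k) $ i) \<longlonglongrightarrow> opinion_map G W b x $ i"
    unfolding opinion_map_nth using x bias[of i] denominator_pos_upper[OF assms(3), of i]
    by (intro tendsto_update) auto
qed

section \<open>Fixed points and convergence\<close>

text \<open>
  At a fixed point, lying above \<open>1/2\<close> is inherited along arcs: an agent that receives an arc from
  such an agent already has opinion \<open>1\<close>.
\<close>

lemma fixed_point_eq_1:
  assumes x: "x \<in> upper" and fixed: "opinion_map G W b x = x" and j: "1/2 < x $ j"
  shows "x $ i = 1"
proof -
  have spread: "x $ v = 1" if "(u, v) \<in> parcs G" "1/2 < x $ u" for u v
  proof (rule update_fixed_eq_1)
    show "update (W $ v $ v) (b $ v) (deg v) (opn x v) (x $ v) = x $ v"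
      using fixed opinion_map_nth[of x v] by simp
    show "deg v / 2 < opn x v"
      using weighted_opinion_gt[OF x that] .
  qed (use x weighted_opinion_bounds[OF x, of v] degree_pos self_weight bias
       in \<open>auto simp: upper_def\<close>)
  have above: "1/2 < x $ u" for u
    using reachable[of j u]
  proof induction
    case base
    show ?case by (fact j)
  next
    case (step u v)
    then show ?case using spread[of u v] by simp
  qed
  show ?thesis
    using ex_neighbor[of i] above spread by blast
qed

theorem orbit_tendsto_1:
  assumes start: "x 0 \<in> upper" "1/2 < x 0 $ j"
    and rec: "\<And>k. x (Suc k) = opinion_map G W b (x k)"
  shows "(\<lambda>k. x k $ i) \<longlonglongrightarrow> 1"
proof -
  have up: "x k \<in> upper" for k
    by (induction k) (simp_all add: start rec opinion_map_upper)
  have mono: "incseq (\<lambda>k. x k $ i)" for i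
    by (rule incseq_SucI) (simp add: rec opinion_map_ge up)
  have "\<forall>k. x k $ i \<le> 1" for i
    using up by (simp add: upper_def)
  then have "\<exists>L. (\<lambda>k. x k $ i) \<longlonglongrightarrow> L" for i
    using incseq_convergent[OF mono[of i]] by metis
  then obtain l where l: "(\<lambda>k. x k $ i) \<longlonglongrightarrow> l i" for i
    by metis
  define L :: "real ^ 'n" where "L = (\<chi> i. l i)"
  have L: "x \<longlonglongrightarrow> L"
    by (rule vec_tendstoI) (simp add: L_def l)
  have ge: "x k $ i \<le> L $ i" for k i
    using incseq_le[OF mono l] by (simp add: L_def)
  have "L $ i \<le> 1" for i
    using up by (intro LIMSEQ_le_const2[OF tendsto_vec_nth[OF L]]) (auto simp: upper_def)
  moreover have "1/2 \<le> L $ i" for i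
    using up[of 0] ge[of 0 i] by (auto simp: upper_def intro: order_trans)
  ultimately have Lup: "L \<in> upper"
    by (simp add: upper_def)
  have "(\<lambda>k. x (Suc k)) \<longlonglongrightarrow> opinion_map G W b L"
    unfolding rec by (rule tendsto_opinion_map[OF L up Lup])
  then have "opinion_map G W b L = L"
    using LIMSEQ_unique LIMSEQ_Suc[OF L] by blast
  then have "L $ i = 1"
    using fixed_point_eq_1[OF Lup, of j i] start(2) ge[of 0 j] by simp
  then show ?thesis
    using tendsto_vec_nth[OF L, of i] by simp
qed

text \<open>
  Reflecting a single step presupposes a profile in \<open>upper\<close>. The orbit of \<open>1 - x 0\<close> stays there
  because \<open>upper\<close> is invariant, so induction on time identifies it with \<open>1 - x\<close>, and it tends
  to \<open>1\<close>.
\<close>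

theorem orbit_tendsto_0:
  assumes start: "1 - x 0 \<in> upper" "x 0 $ j < 1/2"
    and rec: "\<And>k. x (Suc k) = opinion_map G W b (x k)"
  shows "(\<lambda>k. x k $ i) \<longlonglongrightarrow> 0"
proof -
  define y where "y k = (opinion_map G W b ^^ k) (1 - x 0)" for k
  have y0: "y 0 = 1 - x 0" and y_rec: "\<And>k. y (Suc k) = opinion_map G W b (y k)"
    by (simp_all add: y_def)
  have up: "y k \<in> upper" for k
    by (induction k) (simp_all add: y0 start y_rec opinion_map_upper)
  have x_eq: "x k = 1 - y k" for k
    by (induction k) (simp_all add: y0 rec y_rec opinion_map_reflect up)
  have "(\<lambda>k. y k $ i) \<longlonglongrightarrow> 1"
    using start by (intro orbit_tendsto_1[of y j] y_rec) (simp_all add: y0)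
  then have "(\<lambda>k. 1 - y k $ i) \<longlonglongrightarrow> 1 - 1"
    by (intro tendsto_intros)
  then show ?thesis
    by (simp add: x_eq)
qed

end

theorem theorem3:
  fixes G :: "('n::finite) pair_pre_digraph"
    and W :: "real ^ 'n ^ 'n"
    and b :: "real ^ 'n"
    and x :: "nat \<Rightarrow> real ^ 'n"
  assumes "CARD('n) \<ge> 2"
    and "pair_digraph G" and "pverts G = UNIV"
    and "strongly_connected (with_proj G)"
    and "\<And>i. W $ i $ i \<ge> 0"
    and "\<And>i j. (j, i) \<in> parcs G \<Longrightarrow> W $ i $ j > 0"
    and "\<And>i. b $ i \<ge> 1"
    and "\<And>i. x 0 $ i \<in> {0..1}"
    and "\<And>k. x (Suc k) = opinion_map G W b (x k)"
  shows "((\<forall>i. x 0 $ i \<ge> 0.5) \<and> (\<exists>j. x 0 $ j > 0.5) \<longrightarrow> (\<forall>i. (\<lambda>k. x k $ i) \<longlonglongrightarrow> 1)) \<and>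
         ((\<forall>i. x 0 $ i \<le> 0.5) \<and> (\<exists>j. x 0 $ j < 0.5) \<longrightarrow> (\<forall>i. (\<lambda>k. x k $ i) \<longlonglongrightarrow> 0))"
proof -
  interpret biased_network G W b
    using assms by unfold_locales auto
  show ?thesis
  proof (intro conjI impI allI; elim conjE exE)
    fix i j
    assume "\<forall>i. x 0 $ i \<ge> 0.5" "x 0 $ j > 0.5"
    then show "(\<lambda>k. x k $ i) \<longlonglongrightarrow> 1"
      using assms(8) by (intro orbit_tendsto_1[of x j] assms(9)) (auto simp: upper_def)
  next
    fix i j
    assume *: "\<forall>i. x 0 $ i \<le> 0.5" "x 0 $ j < 0.5"
    have "1/2 \<le> 1 - x 0 $ i" for i
      using *(1)[rule_format, of i] by simp
    then show "(\<lambda>k. x k $ i) \<longlonglongrightarrow> 0"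
      using assms(8) *(2) by (intro orbit_tendsto_0[of x j] assms(9)) (auto simp: upper_def)
  qed
qed

end
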